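(* For every correlation-free cellular automaton (CFCA) $F$ with set of states $\{\#,0,1\}$ and every $t$, we have $\mathcal{S}_F^t\neq\mathcal{S}_{\mathrm{Parity}}$.
   Context: A (one-dimensional) stochastic cellular automaton is a tuple $(Q,R,V,V',f)$ where $Q$ (states) and $R$ (random symbols) are finite sets, $V=\{v_1,\dots,v_\rho\}$ and $V'=\{v'_1,\dots,v'_{\rho'}\}$ are finite subsets of $\mathbb{Z}$, and $f:Q^\rho\times R^{\rho'}\to Q$. It is a CFCA if $V'=\{0\}$. It is identified with its explicit global function $F:Q^{\mathbb{Z}}\times R^{\mathbb{Z}}\to Q^{\mathbb{Z}}$, $F(c,s)_z=f\big((c_{z+v_j})_j,(s_{z+v'_j})_j\big)$. Iterates: $F^0(c)=c$, $F^{t+1}(c,s^1,\dots,s^{t+1})=F(F^t(c,s^1,\dots,s^t),s^{t+1})$. $\mathcal{S}_F^t(c)$ is the law of $F^t(c,s^1,\dots,s^t)$ when $s^1,\dots,s^t$ are independent and each drawn from the uniform (i.i.d. uniform product) measure on $R^{\mathbb{Z}}$; $\mathcal{S}_F=\mathcal{S}_F^1$. $\mathrm{Parity}$ is the stochastic CA with $Q=\{\#,0,1\}$, $R=\{0,1\}$, $V=\{-1,0,1\}$, $V'=\{-1,0\}$ and local function given, for all $c_{-1},c_0,c_1,s_{-1},s_0\in\{0,1\}$ and $a,b\in\{\#,0,1\}$, by $f(a\#b,s_{-1}s_0)=\#$; $f(\#c_0\#,s_{-1}s_0)=0$; $f(\#c_0c_1,s_{-1}s_0)=s_0$; $f(c_{-1}c_0\#,s_{-1}s_0)=s_{-1}$;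 $f(c_{-1}c_0c_1,s_{-1}s_0)=s_{-1}+s_0$ (mod 2). (It maps every $\{0,1\}$-word delimited by two consecutive $\#$ to an independent uniformly random word of the same length with even parity.) *)

theory Defs
  imports "HOL-Probability.Probability" "HOL-Library.Z2"
begin

(* The tuple (Q, R, V, V', f). Q and R are the finite types 'q and 'r. The finite sets
   V = {v_1, ..., v_rho} and V' = {v'_1, ..., v'_rho'} come with an enumeration, which fixes
   the order of the arguments of f, so they are represented by lists without repetition.
   Only the values of f on lists of length rho and rho' matter. *)
record ('q, 'r) stoch_ca =
  nbhd :: "int list"
  rnbhd :: "int list"
  local_rule :: "'q list \<Rightarrow> 'r list \<Rightarrow> 'q"

definition stoch_ca :: "('q::finite, 'r::finite) stoch_ca \<Rightarrow> bool" where
  "stoch_ca F \<longleftrightarrow> distinct (nbhd F) \<and> distinct (rnbhd F)"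

definition cfca :: "('q::finite, 'r::finite) stoch_ca \<Rightarrow> bool" where
  "cfca F \<longleftrightarrow> stoch_ca F \<and> set (rnbhd F) = {0}"

definition global_fun ::
    "('q::finite, 'r::finite) stoch_ca \<Rightarrow> (int \<Rightarrow> 'q) \<Rightarrow> (int \<Rightarrow> 'r) \<Rightarrow> (int \<Rightarrow> 'q)" where
  "global_fun F c s =
     (\<lambda>z. local_rule F (map (\<lambda>v. c (z + v)) (nbhd F)) (map (\<lambda>v. s (z + v)) (rnbhd F)))"

(* s k is the random configuration s^k; F^t reads s^1, ..., s^t only. *)
fun iterate ::
    "('q::finite, 'r::finite) stoch_ca \<Rightarrow> nat \<Rightarrow> (int \<Rightarrow> 'q) \<Rightarrow> (nat \<Rightarrow> int \<Rightarrow> 'r) \<Rightarrow> (int \<Rightarrow> 'q)"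
  where
  "iterate F 0 c s = c"
| "iterate F (Suc t) c s = global_fun F (iterate F t c s) (s (Suc t))"

(* Configurations carry the sigma-algebra generated by the cylinders. *)
definition config_space :: "(int \<Rightarrow> 'q::finite) measure" where
  "config_space = PiM UNIV (\<lambda>_. count_space UNIV)"

definition uniform_config :: "(int \<Rightarrow> 'r::finite) measure" where
  "uniform_config = PiM UNIV (\<lambda>_. uniform_count_measure UNIV)"

(* S_F^t(c) *)
definition stoch_law ::
    "('q::finite, 'r::finite) stoch_ca \<Rightarrow> nat \<Rightarrow> (int \<Rightarrow> 'q) \<Rightarrow> (int \<Rightarrow> 'q) measure" where
  "stoch_law F t c =
     distr (PiM {1..t} (\<lambda>_. uniform_config)) config_space (\<lambda>s. iterate F t c s)"

(* distr is the image measure only for measurable maps; the iterates are measurable. *)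
lemma measurable_iterate:
  fixes F :: "('q::finite, 'r::finite) stoch_ca"
  shows "(\<lambda>s. iterate F t c s) \<in> measurable (PiM {1..t} (\<lambda>_. uniform_config)) config_space"
proof -
  have list: "(\<lambda>x. map (\<lambda>v. g v x) vs) \<in> measurable M (count_space UNIV)"
    if "\<And>v. g v \<in> measurable M (count_space UNIV)"
    for M :: "(nat \<Rightarrow> int \<Rightarrow> 'r) measure" and g :: "int \<Rightarrow> (nat \<Rightarrow> int \<Rightarrow> 'r) \<Rightarrow> 'a::finite" and vs
  proof (induction vs)
    case (Cons a vs)
    have "(\<lambda>x. g a x # map (\<lambda>v. g v x) vs) \<in> measurable M (count_space UNIV)"
      by (rule measurable_compose_countable[OF _ that[of a], of "\<lambda>i x. i # map (\<lambda>v. g v x) vs"])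
         (rule measurable_compose[OF Cons.IH], simp)
    then show ?case by simp
  qed simp
  have "(\<lambda>s. iterate F k c s) \<in> measurable (PiM {1..t} (\<lambda>_. uniform_config)) config_space"
    if "k \<le> t" for k
    using that
  proof (induction k)
    case 0
    then show ?case by (auto simp: config_space_def space_PiM)
  next
    case (Suc k)
    let ?M = "PiM {1..t} (\<lambda>_. uniform_config :: (int \<Rightarrow> 'r) measure)"
    have c: "(\<lambda>s. iterate F k c s z) \<in> measurable ?M (count_space UNIV)" for z
      using measurable_compose[OF Suc.IH, of "\<lambda>f. f z" "count_space UNIV"] Suc.prems
      by (auto simp: config_space_def)
    have "(\<lambda>s. s (Suc k)) \<in> measurable ?M uniform_config"
      using Suc.prems by (intro measurable_component_singleton) auto
    moreover have "(\<lambda>f. f z) \<in> measurable (uniform_config :: (int \<Rightarrow> 'r) measure) (count_space UNIV)" for z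
    proof -
      have "(\<lambda>f. f z) \<in> measurable (uniform_config :: (int \<Rightarrow> 'r) measure) (uniform_count_measure UNIV)"
        unfolding uniform_config_def by (intro measurable_component_singleton) auto
      moreover have "sets (uniform_count_measure (UNIV :: 'r set)) = sets (count_space UNIV)"
        by (simp add: sets_uniform_count_measure)
      ultimately show ?thesis by (metis measurable_cong_sets)
    qed
    ultimately have r: "(\<lambda>s. s (Suc k) z) \<in> measurable ?M (count_space UNIV)" for z
      by (rule measurable_compose)
    have "(\<lambda>s. local_rule F (map (\<lambda>v. iterate F k c s (z + v)) (nbhd F))
             (map (\<lambda>v. s (Suc k) (z + v)) (rnbhd F))) \<in> measurable ?M (count_space UNIV)" for z
    proof (rule measurable_compose_countable[OF _ list[OF c]])
      show "(\<lambda>s. local_rule F i (map (\<lambda>v. s (Suc k) (z + v)) (rnbhd F))) \<in> measurable ?M (count_space UNIV)"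
        for i
        by (rule measurable_compose[OF list[OF r]]) simp
    qed
    then show ?case
      by (auto simp: global_fun_def config_space_def intro!: measurable_PiM_single')
  qed
  then show ?thesis by simp
qed

(* The state set {#, 0, 1}, with # = Hash; bit is the two-element field {0, 1}. *)
datatype cell = Hash | Digit bit

instance bit :: finite
proof
  have "(UNIV :: bit set) = {0, 1}" by (auto)
  then show "finite (UNIV :: bit set)" by (metis finite.emptyI finite_insert)
qed

instance cell :: finite
proof
  have "(UNIV :: cell set) = insert Hash (range Digit)"
    by (auto intro: cell.exhaust)
  then show "finite (UNIV :: cell set)" by (metis finite finite_imageI finite_insert)
qed

(* parity_rule c_{-1} c_0 c_1 s_{-1} s_0 *)
fun parity_rule :: "cell \<Rightarrow> cell \<Rightarrow> cell \<Rightarrow> bit \<Rightarrow> bit \<Rightarrow> cell" where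
  "parity_rule a Hash b s' s = Hash"
| "parity_rule Hash (Digit c0) Hash s' s = Digit 0"
| "parity_rule Hash (Digit c0) (Digit c1) s' s = Digit s"
| "parity_rule (Digit c') (Digit c0) Hash s' s = Digit s'"
| "parity_rule (Digit c') (Digit c0) (Digit c1) s' s = Digit (s' + s)"

definition Parity :: "(cell, bit) stoch_ca" where
  "Parity = \<lparr> nbhd = [-1, 0, 1], rnbhd = [-1, 0],
     local_rule = (\<lambda>c s. parity_rule (c ! 0) (c ! 1) (c ! 2) (s ! 0) (s ! 1)) \<rparr>"

end

theory Submission
  imports Defs
begin

text \<open>Suppose that \<open>F\<close> is a CFCA whose \<open>t\<close>-th iterate simulates Parity. Given the configuration
  reached after \<open>t - 1\<close> steps, the last step acts independently on the cells; as its possible outcomes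
  all have even parity on each delimited word, it is deterministic. The configurations reachable in
  \<open>t\<close> steps are also reachable in \<open>t - 1\<close> steps, so \<open>F\<close> is deterministic along every
  trajectory that starts from a configuration reachable in \<open>t\<close> steps. The configuration with
  \<open>00\<close> in the cells 0 and 1 and \<open>#\<close> elsewhere is a possible outcome of Parity, hence reachable in
  \<open>t\<close> steps, but Parity is not deterministic on it.\<close>

section \<open>Finite windows and patterns of positive probability\<close>

text \<open>Pulling \<open>A\<close> back through the neighbourhoods, one step at a time, keeps it
  finite. The same \<open>B\<close> serves for the initial and all random configurations.\<close>

lemma iterate_local:
  fixes F :: "('q::finite, 'r::finite) stoch_ca"
  assumes "finite A"
  shows "\<exists>B. finite B \<and> (\<forall>c c' s s'. (\<forall>y\<in>B. c y = c' y) \<longrightarrow>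
    (\<forall>k\<in>{1..t}. \<forall>y\<in>B. s k y = s' k y) \<longrightarrow>
    (\<forall>z\<in>A. iterate F t c s z = iterate F t c' s' z))"
  using assms
proof (induction t arbitrary: A)
  case 0
  then show ?case by auto
next
  case (Suc t)
  let ?N = "(\<lambda>(z, v). z + v) ` (A \<times> set (nbhd F))"
  let ?R = "(\<lambda>(z, v). z + v) ` (A \<times> set (rnbhd F))"
  have fin: "finite ?N" "finite ?R" using Suc.prems by auto
  obtain B where B: "finite B"
    and eq: "\<forall>c c' s s'. (\<forall>y\<in>B. c y = c' y) \<longrightarrow> (\<forall>k\<in>{1..t}. \<forall>y\<in>B. s k y = s' k y) \<longrightarrow>
       (\<forall>z\<in>?N. iterate F t c s z = iterate F t c' s' z)"
    using Suc.IH[OF fin(1)] by blast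
  show ?case
  proof (rule exI[of _ "B \<union> ?R"], intro conjI allI impI ballI)
    show "finite (B \<union> ?R)" using B fin by simp
    fix c c' :: "int \<Rightarrow> 'q" and s s' :: "nat \<Rightarrow> int \<Rightarrow> 'r" and z
    assume c: "\<forall>y\<in>B \<union> ?R. c y = c' y" and s: "\<forall>k\<in>{1..Suc t}. \<forall>y\<in>B \<union> ?R. s k y = s' k y"
      and z: "z \<in> A"
    have "\<forall>z\<in>?N. iterate F t c s z = iterate F t c' s' z"
      by (rule eq[THEN spec, THEN spec, THEN spec, THEN spec, THEN mp, THEN mp]) (use c s in auto)
    then have "iterate F t c s (z + v) = iterate F t c' s' (z + v)" if "v \<in> set (nbhd F)" for v
      using z that by force
    moreover have "s (Suc t) (z + v) = s' (Suc t) (z + v)" if "v \<in> set (rnbhd F)" for v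
    proof -
      have "z + v \<in> ?R" using z that by force
      then show ?thesis using s by auto
    qed
    ultimately show "iterate F (Suc t) c s z = iterate F (Suc t) c' s' z"
      by (simp add: global_fun_def cong: map_cong)
  qed
qed

lemma iterate_cong:
  assumes "\<And>k. 1 \<le> k \<Longrightarrow> k \<le> t \<Longrightarrow> s k = s' k"
  shows "iterate F t c s = iterate F t c s'"
  using assms by (induction t) auto

lemma space_uniform_config [simp]: "space uniform_config = UNIV"
  by (simp add: uniform_config_def space_PiM space_uniform_count_measure PiE_def)

lemma prob_space_uniform_config: "prob_space uniform_config"
  unfolding uniform_config_def
  by (intro prob_space_PiM prob_space_uniform_count_measure) auto

lemma cylinder_in_sets_config_space:
  assumes "finite A"
  shows "{x :: int \<Rightarrow> 'q::finite. \<forall>z\<in>A. x z = g z} \<in> sets config_space"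
proof -
  have "{x :: int \<Rightarrow> 'q. \<forall>z\<in>A. x z = g z}
      = prod_emb UNIV (\<lambda>_. count_space UNIV) A (\<Pi>\<^sub>E z\<in>A. {g z})"
    by (auto simp: prod_emb_def PiE_def Pi_def)
  then show ?thesis
    unfolding config_space_def using assms by (simp add: sets_PiM_I)
qed

lemma cylinder_uniform_config:
  fixes g :: "int \<Rightarrow> 'r::finite"
  assumes "finite B"
  shows "{x. \<forall>z\<in>B. x z = g z} \<in> sets uniform_config"
    and "emeasure uniform_config {x. \<forall>z\<in>B. x z = g z} > 0"
proof -
  let ?M = "\<lambda>_::int. uniform_count_measure (UNIV :: 'r set)"
  have eq: "{x. \<forall>z\<in>B. x z = g z} = prod_emb UNIV ?M B (\<Pi>\<^sub>E z\<in>B. {g z})"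
    by (auto simp: prod_emb_def PiE_def Pi_def space_uniform_count_measure)
  show "{x. \<forall>z\<in>B. x z = g z} \<in> sets uniform_config"
    unfolding eq uniform_config_def using assms
    by (intro sets_PiM_I) (auto simp: sets_uniform_count_measure)
  have "emeasure uniform_config {x. \<forall>z\<in>B. x z = g z} = (\<Prod>z\<in>B. emeasure (?M z) {g z})"
    unfolding eq uniform_config_def using assms
    by (intro emeasure_PiM_emb prob_space_uniform_count_measure)
      (auto simp: sets_uniform_count_measure)
  also have "\<dots> > 0"
    by (auto simp: emeasure_uniform_count_measure zero_less_iff_neq_zero prod_zero_iff assms
        card_gt_0_iff)
  finally show "emeasure uniform_config {x. \<forall>z\<in>B. x z = g z} > 0" .
qed

text \<open>By \<open>iterate_local\<close> the pattern on \<open>A\<close> is forced by finitely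
  many random symbols, and prescribing finitely many independent uniform symbols has positive
  probability.\<close>

lemma emeasure_stoch_law_cylinder_pos:
  fixes F :: "('q::finite, 'r::finite) stoch_ca"
  assumes "finite A"
  shows "emeasure (stoch_law F t c) {x. \<forall>z\<in>A. x z = iterate F t c s z} > 0"
proof -
  interpret prob_space "uniform_config :: (int \<Rightarrow> 'r) measure"
    by (rule prob_space_uniform_config)
  interpret product_sigma_finite "\<lambda>_::nat. uniform_config :: (int \<Rightarrow> 'r) measure"
    by unfold_locales
  let ?P = "PiM {1..t} (\<lambda>_. uniform_config :: (int \<Rightarrow> 'r) measure)"
  let ?C = "{x. \<forall>z\<in>A. x z = iterate F t c s z}"
  obtain B where B: "finite B"
    and eq: "\<forall>c c' s s'. (\<forall>y\<in>B. c y = c' y) \<longrightarrow> (\<forall>k\<in>{1..t}. \<forall>y\<in>B. s k y = s' k y) \<longrightarrow>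
       (\<forall>z\<in>A. iterate F t c s z = iterate F t c' s' z)"
    using iterate_local[OF assms, where t = t and F = F] by (elim exE conjE) (rule that)
  let ?E = "\<lambda>k. {x. \<forall>z\<in>B. x z = s k z}"
  note C = cylinder_in_sets_config_space[OF assms, of "iterate F t c s"]
  have "0 < (\<Prod>k\<in>{1..t}. emeasure uniform_config (?E k))"
    using cylinder_uniform_config(2)[OF B]
    by (auto simp: zero_less_iff_neq_zero prod_zero_iff)
  also have "\<dots> = emeasure ?P (Pi\<^sub>E {1..t} ?E)"
    by (rule emeasure_PiM[symmetric]) (auto intro: cylinder_uniform_config(1)[OF B])
  also have "\<dots> \<le> emeasure ?P ((\<lambda>s. iterate F t c s) -` ?C \<inter> space ?P)"
  proof (rule emeasure_mono)
    show "Pi\<^sub>E {1..t} ?E \<subseteq> (\<lambda>s. iterate F t c s) -` ?C \<inter> space ?P"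
    proof
      fix s' assume s': "s' \<in> Pi\<^sub>E {1..t} ?E"
      have "iterate F t c s' z = iterate F t c s z" if "z \<in> A" for z
        by (rule eq[rule_format, OF _ _ that]) (use s' in \<open>auto simp: PiE_iff\<close>)
      then show "s' \<in> (\<lambda>s. iterate F t c s) -` ?C \<inter> space ?P"
        using s' by (auto simp: space_PiM PiE_iff)
    qed
    show "(\<lambda>s. iterate F t c s) -` ?C \<inter> space ?P \<in> sets ?P"
      by (rule measurable_sets[OF measurable_iterate C])
  qed
  also have "\<dots> = emeasure (stoch_law F t c) ?C"
    unfolding stoch_law_def by (rule emeasure_distr[OF measurable_iterate C, symmetric])
  finally show ?thesis .
qed

text \<open>A pattern of positive probability under one automaton must be attained by the other.
  Equality of laws enters the argument only in this form.\<close>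

lemma stoch_law_eq_imp_same_patterns:
  fixes F :: "('q::finite, 'r::finite) stoch_ca" and G :: "('q, 'p::finite) stoch_ca"
  assumes "stoch_law F t c = stoch_law G u c" and "finite A"
  obtains s' where "\<And>z. z \<in> A \<Longrightarrow> iterate F t c s z = iterate G u c s' z"
proof -
  let ?C = "{x. \<forall>z\<in>A. x z = iterate F t c s z}"
  let ?P = "PiM {1..u} (\<lambda>_. uniform_config :: (int \<Rightarrow> 'p) measure)"
  have "0 < emeasure (stoch_law G u c) ?C"
    using emeasure_stoch_law_cylinder_pos[OF assms(2), of F t c s] assms(1) by simp
  also have "\<dots> = emeasure ?P ((\<lambda>s. iterate G u c s) -` ?C \<inter> space ?P)"
    unfolding stoch_law_def
    by (rule emeasure_distr[OF measurable_iterate cylinder_in_sets_config_space[OF assms(2)]])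
  finally have "(\<lambda>s. iterate G u c s) -` ?C \<inter> space ?P \<noteq> {}"
    by (metis emeasure_empty less_irrefl)
  then obtain s' where "iterate G u c s' \<in> ?C" by blast
  then show thesis by (intro that[of s']) simp
qed

section \<open>Reachable configurations\<close>

fun reach :: "('q::finite, 'r::finite) stoch_ca \<Rightarrow> nat \<Rightarrow> (int \<Rightarrow> 'q) set" where
  "reach F 0 = UNIV"
| "reach F (Suc k) = {global_fun F d u | d u. d \<in> reach F k}"

text \<open>The first step of a trajectory can be forgotten, since its second configuration is
  itself an admissible start.\<close>

lemma reach_Suc_subset: "reach F (Suc k) \<subseteq> reach F k"
  by (induction k) auto

lemma iterate_in_reach: "iterate F k c s \<in> reach F k"
  by (induction k) auto

lemma iterate_stays_in_reach: "c \<in> reach F n \<Longrightarrow> iterate F k c s \<in> reach F n"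
proof (induction k)
  case (Suc k)
  then show ?case using reach_Suc_subset[of F n] by auto
qed simp

lemma reachE:
  assumes "d \<in> reach F k"
  obtains c s where "d = iterate F k c s"
  using assms
proof (induction k arbitrary: d thesis)
  case (Suc k)
  then obtain e u where "d = global_fun F e u" "e \<in> reach F k" by auto
  moreover from this obtain c s where "e = iterate F k c s" using Suc.IH by blast
  moreover have "iterate F k c (s(Suc k := u)) = iterate F k c s"
    by (rule iterate_cong) simp
  ultimately have "d = iterate F (Suc k) c (s(Suc k := u))" by simp
  then show ?case by (rule Suc.prems(1))
qed simp

text \<open>This is where being correlation-free enters: the only random symbol read at
  \<open>z\<close> is the one at \<open>z\<close>, so one cell can be resampled alone.\<close>

lemma cfca_global_fun_cong:
  assumes "cfca F" "u z = v z"
  shows "global_fun F c u z = global_fun F c v z"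
proof -
  have "map (\<lambda>i. u (z + i)) (rnbhd F) = map (\<lambda>i. v (z + i)) (rnbhd F)"
    using assms by (auto simp: cfca_def)
  then show ?thesis by (simp only: global_fun_def)
qed

section \<open>Even parity of the outcomes of Parity\<close>

text \<open>With value 0 for \<open>Hash\<close>, one sum over an interval covers all the words in
  it.\<close>

fun cell_val :: "cell \<Rightarrow> bit" where
  "cell_val Hash = 0"
| "cell_val (Digit x) = x"

lemma Parity_eq_Hash_iff: "global_fun Parity c s z = Hash \<longleftrightarrow> c z = Hash"
  by (cases "c (z - 1)"; cases "c z"; cases "c (z + 1)") (simp_all add: global_fun_def Parity_def)

text \<open>Each random bit shared by two neighbouring digits of \<open>c\<close> contributes to both of them, so
  that sums of cell values telescope modulo 2.\<close>

lemma cell_val_Parity: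
  fixes c s
  defines "g \<equiv> \<lambda>z. if c z \<noteq> Hash \<and> c (z + 1) \<noteq> Hash then s z else 0"
  shows "cell_val (global_fun Parity c s z) = g (z - 1) + g z"
  by (cases "c (z - 1)"; cases "c z"; cases "c (z + 1)")
    (simp_all add: global_fun_def Parity_def g_def)

lemma sum_bit_telescope:
  fixes g :: "int \<Rightarrow> bit"
  shows "(\<Sum>z = a..a + int n. g (z - 1) + g z) = g (a - 1) + g (a + int n)"
proof (induction n)
  case (Suc n)
  have "{a..a + int (Suc n)} = insert (a + int n + 1) {a..a + int n}" by auto
  then have "(\<Sum>z = a..a + int (Suc n). g (z - 1) + g z)
      = (g (a + int n) + g (a + int (Suc n))) + (\<Sum>z = a..a + int n. g (z - 1) + g z)"
    by (simp del: add_bit_eq_xor add: algebra_simps)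
  then show ?case
    unfolding Suc.IH
    by (cases "g (a - 1)"; cases "g (a + int n)"; cases "g (a + int (Suc n))") (simp_all only:, simp_all)
qed simp

text \<open>Telescoping leaves the two bits shared across the ends of the interval, and both vanish
  because \<open>c\<close> is \<open>Hash\<close> just outside.\<close>

lemma sum_cell_val_Parity:
  assumes "\<And>z. z \<notin> {-int n..int n} \<Longrightarrow> c z = Hash"
  shows "(\<Sum>z = -int n..int n. cell_val (global_fun Parity c s z)) = 0"
proof -
  have "c (- int n - 1) = Hash" "c (int n + 1) = Hash" by (auto intro: assms)
  then show ?thesis
    using sum_bit_telescope[of "\<lambda>z. if c z \<noteq> Hash \<and> c (z + 1) \<noteq> Hash then s z else 0" "-int n" "2 * n"]
    by (simp add: cell_val_Parity)
qed

section \<open>Determinism and the contradiction\<close>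

text \<open>If two outcomes differed at some cell, that cell could be changed alone, which would
  flip a sum that has to be 0.\<close>

lemma cfca_last_step_deterministic:
  fixes F :: "(cell, 'r::finite) stoch_ca"
  assumes F: "cfca F"
    and law: "\<And>c. stoch_law F (Suc m) c = stoch_law Parity 1 c"
    and d: "d \<in> reach F m"
  shows "global_fun F d u = global_fun F d v"
proof
  fix z :: int
  obtain c s where c: "d = iterate F m c s" using d by (rule reachE)
  have "finite {z}" by simp
  from iterate_local[OF this, where t = "Suc m" and F = F] obtain B where B: "finite B"
    and eq: "\<forall>c c' s s'. (\<forall>y\<in>B. c y = c' y) \<longrightarrow> (\<forall>k\<in>{1..Suc m}. \<forall>y\<in>B. s k y = s' k y) \<longrightarrow>
       (\<forall>y\<in>{z}. iterate F (Suc m) c s y = iterate F (Suc m) c' s' y)"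
    by (elim exE conjE) (rule that)
  text \<open>The values of \<open>c\<close> far from \<open>z\<close> do not matter, so every word may be assumed finite.\<close>
  define c' where "c' y = (if y \<in> insert z B then c y else Hash)" for y
  define d' where "d' = iterate F m c' s"
  \<comment> \<open>Entry \<open>Suc m\<close> is read by the last step only, so it can be set to
    any \<open>w\<close> without disturbing the first \<open>m\<close> steps.\<close>
  have step: "iterate F (Suc m) e (s(Suc m := w)) = global_fun F (iterate F m e s) w" for e w
  proof -
    have "iterate F m e (s(Suc m := w)) = iterate F m e s" by (rule iterate_cong) simp
    then show ?thesis by simp
  qed
  have d': "global_fun F d w z = global_fun F d' w z" for w
    unfolding c d'_def step[symmetric] by (rule eq[rule_format]) (auto simp: c'_def)
  obtain n where n: "insert z B \<subseteq> {-int n..int n}"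
  proof -
    define N where "N = Max (abs ` insert z B)"
    have N: "\<bar>y\<bar> \<le> N" if "y \<in> insert z B" for y
      unfolding N_def by (rule Max_ge) (use that B in auto)
    have "insert z B \<subseteq> {-int (nat N)..int (nat N)}"
    proof
      fix y assume "y \<in> insert z B"
      from N[OF this] show "y \<in> {-int (nat N)..int (nat N)}" by auto
    qed
    then show thesis by (rule that)
  qed
  have Parity: "\<exists>s'. \<forall>y\<in>{-int n..int n}. global_fun F d' w y = global_fun Parity c' s' y" for w
  proof -
    obtain s' where "\<And>y. y \<in> {-int n..int n} \<Longrightarrow>
        iterate F (Suc m) c' (s(Suc m := w)) y = iterate Parity 1 c' s' y"
      using stoch_law_eq_imp_same_patterns[OF law finite_atLeastAtMost_int] by blast
    then show ?thesis unfolding step d'_def by auto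
  qed
  have sum0: "(\<Sum>y = -int n..int n. cell_val (global_fun F d' w y)) = 0" for w
  proof -
    obtain s' where "\<forall>y\<in>{-int n..int n}. global_fun F d' w y = global_fun Parity c' s' y"
      using Parity by blast
    then have "(\<Sum>y = -int n..int n. cell_val (global_fun F d' w y))
        = (\<Sum>y = -int n..int n. cell_val (global_fun Parity c' s' y))"
      by (intro sum.cong) auto
    also have "\<dots> = 0"
      by (rule sum_cell_val_Parity) (use n in \<open>auto simp: c'_def\<close>)
    finally show ?thesis .
  qed
  \<comment> \<open>\<open>Hash\<close> and \<open>Digit 0\<close> have the same
    \<open>cell_val\<close>, so the sum alone does not separate them.\<close>
  have Hash: "global_fun F d' w z = Hash \<longleftrightarrow> c' z = Hash" for w
    using Parity[of w] n Parity_eq_Hash_iff by (metis insert_subset)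
  \<comment> \<open>\<open>?w\<close> acts like \<open>u\<close> away from \<open>z\<close> and like
    \<open>v\<close> at \<open>z\<close>.\<close>
  let ?w = "u(z := v z)"
  have z: "z \<in> {-int n..int n}" using n by simp
  have "(\<Sum>y\<in>{-int n..int n} - {z}. cell_val (global_fun F d' u y))
      = (\<Sum>y\<in>{-int n..int n} - {z}. cell_val (global_fun F d' ?w y))"
    by (intro sum.cong refl arg_cong[of _ _ cell_val] cfca_global_fun_cong[OF F]) auto
  then have "cell_val (global_fun F d' u z) = cell_val (global_fun F d' ?w z)"
    using sum0[of u, unfolded sum.remove[OF finite_atLeastAtMost_int z]]
      sum0[of ?w, unfolded sum.remove[OF finite_atLeastAtMost_int z]]
    by (metis add_right_cancel)
  then have "global_fun F d' u z = global_fun F d' ?w z"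
    using Hash[of u] Hash[of ?w]
    by (cases "global_fun F d' u z"; cases "global_fun F d' ?w z") auto
  also have "\<dots> = global_fun F d' v z"
    by (rule cfca_global_fun_cong[OF F]) simp
  finally show "global_fun F d u z = global_fun F d v z" by (simp add: d')
qed

theorem theorem5p5:
  fixes F :: "(cell, 'r::finite) stoch_ca" and t :: nat
  assumes "cfca F"
  shows "stoch_law F t \<noteq> stoch_law Parity 1"
proof
  assume law: "stoch_law F t = stoch_law Parity 1"
  \<comment> \<open>A word of length 2 is the shortest with two outcomes under Parity,
    \<open>00\<close> and \<open>11\<close>.\<close>
  define c0 :: "int \<Rightarrow> cell" where "c0 z = (if z \<in> {0, 1} then Digit 0 else Hash)" for z
  \<comment> \<open>Patterns are compared on finite windows only. Fixing all other cells for every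
    \<open>s\<close> makes the outcome \<open>00\<close> equal to \<open>c0\<close>
    everywhere.\<close>
  have Hash: "iterate F t c0 s z = Hash" if "z \<notin> {0, 1}" for s z
  proof -
    obtain s' where "\<And>y. y \<in> {z} \<Longrightarrow> iterate F t c0 s y = iterate Parity 1 c0 s' y"
      using stoch_law_eq_imp_same_patterns[OF fun_cong[OF law], of "{z}" c0 s] by blast
    then show ?thesis using that by (simp add: Parity_eq_Hash_iff c0_def)
  qed
  have outcome: "\<exists>s. \<forall>z\<in>{0, 1}. iterate F t c0 s z = Digit b" for b
  proof -
    \<comment> \<open>Both cells copy the random bit at position 0, which they share.\<close>
    have b: "global_fun Parity c0 (\<lambda>_. b) z = Digit b" if "z \<in> {0, 1}" for z
      using that by (auto simp: global_fun_def Parity_def c0_def)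
    obtain s where "\<And>z. z \<in> {0, 1} \<Longrightarrow>
        iterate Parity 1 c0 (\<lambda>_ _. b) z = iterate F t c0 s z"
      using stoch_law_eq_imp_same_patterns[OF fun_cong[OF law[symmetric]], of "{0, 1}" c0 "\<lambda>_ _. b"]
      by blast
    then have "iterate F t c0 s z = Digit b" if "z \<in> {0, 1}" for z
      using b[OF that] that by (metis One_nat_def iterate.simps)
    then show ?thesis by blast
  qed
  obtain s where "\<forall>z\<in>{0, 1}. iterate F t c0 s z = Digit 0" using outcome by blast
  then have "iterate F t c0 s = c0" using Hash by (fastforce simp: c0_def)
  then have c0: "c0 \<in> reach F t" by (metis iterate_in_reach)
  have deterministic: "iterate F t c0 s = iterate F t c0 s'" for s s'
  proof (cases t)
    case (Suc m)
    have "iterate F k c0 s = iterate F k c0 s'" for k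
    proof (induction k)
      case (Suc k)
      \<comment> \<open>The trajectory never leaves \<open>reach F m\<close>, so determinism of the
        last step applies at every step.\<close>
      have "iterate F k c0 s' \<in> reach F m"
        using iterate_stays_in_reach[OF c0] reach_Suc_subset \<open>t = Suc m\<close> by blast
      then show ?case
        using cfca_last_step_deterministic[OF assms fun_cong[OF law[unfolded \<open>t = Suc m\<close>]]] Suc.IH
        by simp
    qed simp
    then show ?thesis .
  qed simp
  obtain s0 s1 where "iterate F t c0 s0 0 = Digit 0" "iterate F t c0 s1 0 = Digit 1"
    using outcome by blast
  then show False using deterministic[of s0 s1] by simp
qed

end
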